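(* For every $k\ge0$ and every $\alpha_i\in[k]$, $i=1,\dots,|[k]|$, the second kind function $C_{\alpha_i}$ is the multivariate Cauchy transform of the orthogonal polynomial $P_{\alpha_i}$: $$C_{\alpha_i}(z)=\int_\Omega\frac{P_{\alpha_i}(y)}{(z_1-y_1)\cdots(z_D-y_D)}\,d\mu(y),\qquad \forall z\in\mathscr D_{\alpha_i}\setminus\operatorname{supp}(d\mu).$$
   Context: Let $D\ge 1$ and let $\mu$ be a Borel measure on $\Omega\subseteq\mathbb R^D$ with finite moments. For $k\in\mathbb Z_+$ let $[k]=\{\alpha\in\mathbb Z_+^D:|\alpha|=k\}=\{\alpha_1,\dots,\alpha_{|[k]|}\}$, ordered so that $\alpha>\alpha'$ iff at the first coordinate where they differ the entry of $\alpha$ is smaller. $\chi_{[k]}(x)$ is the column vector of monomials $x^\alpha$, $\alpha\in[k]$, in this order, and $\chi$ is the semi-infinite column stacking $\chi_{[0]},\chi_{[1]},\dots$. Put $\chi^*(z)=\big(\prod_{a=1}^Dz_a^{-1}\big)\chi(z_1^{-1},\dots,z_D^{-1})$. Semi-infinite matrices are partitioned in blocks $A_{[k],[\ell]}\in\mathbb R^{|[k]|\times|[\ell]|}$; $A^{[\ell]}$ is the truncation to the first $\ell$ block rows and columns. The moment matrix is $G=\int_\Omega\chi\,d\mu\,\chi^\top$. Standing assumption: $\det G^{[\ell]}\ne0$ for all $\ell$, so that $G=S^{-1}H(S^{-1})^\top$ with $S$ block lower triangular with identity diagonal blocks and $H=\operatorname{diag}(H_{[0]},H_{[1]},\dots)$.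 The orthogonal polynomials are $P=S\chi$, with blocks $P_{[k]}$ having entries $P_{\alpha_i}$, $\alpha_i\in[k]$. The second kind functions are the entries $C_{\alpha_i}$ of the blocks $C_{[k]}$ of $C=H(S^{-1})^\top\chi^*$, i.e. of the multiple Laurent series $$C_{[\ell]}(z)=H_{[\ell]}\sum_{k=\ell}^\infty\big((S^{-1})_{[k],[\ell]}\big)^\top\chi^*_{[k]}(z),\qquad z\in\mathbb C^D.$$ $\mathscr D_{\alpha_i}\subset\mathbb C^D$ is the domain of convergence of the Laurent series $C_{\alpha_i}$: in the variable $w=(z_1^{-1},\dots,z_D^{-1})$ it is a power series, and its domain of convergence (the largest open set of absolute convergence) is a complete Reinhardt domain. *)

theory Defs
  imports "HOL-Analysis.Analysis" "Jordan_Normal_Form.Determinant"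
begin

no_notation vec_index (infixl \<open>$\<close> 100)

text \<open>
  The dimension is \<open>D = CARD('n)\<close>; the linear order on \<open>'n\<close> orders the coordinates.
\<close>

type_synonym 'n multi_index = "nat ^ 'n"

definition mi_degree :: "'n::finite multi_index \<Rightarrow> nat" where
  "mi_degree \<alpha> = (\<Sum>a\<in>UNIV. \<alpha> $ a)"

definition mi_block :: "nat \<Rightarrow> 'n::finite multi_index set" where
  "mi_block k = {\<alpha>. mi_degree \<alpha> = k}"

definition mi_less :: "'n::{finite,linorder} multi_index \<Rightarrow> 'n multi_index \<Rightarrow> bool" where
  "mi_less \<alpha>' \<alpha> \<longleftrightarrow> (\<exists>a. (\<forall>b<a. \<alpha> $ b = \<alpha>' $ b) \<and> \<alpha> $ a < \<alpha>' $ a)"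

definition mi_block_list :: "nat \<Rightarrow> 'n::{finite,linorder} multi_index list" where
  "mi_block_list k = (THE xs. set xs = mi_block k \<and> sorted_wrt mi_less xs)"

definition monom_eval :: "'n::finite multi_index \<Rightarrow> 'a::comm_semiring_1 ^ 'n \<Rightarrow> 'a" where
  "monom_eval \<alpha> x = (\<Prod>a\<in>UNIV. (x $ a) ^ (\<alpha> $ a))"

text \<open>
  A semi-infinite matrix is indexed directly by multi-indices: the entry in row \<open>\<alpha>\<close> and column
  \<open>\<beta>\<close> belongs to the block \<open>([|\<alpha>|], [|\<beta>|])\<close>. The order of the rows and columns only matters when
  a truncation is turned into a matrix of numbered rows and columns. All matrix products below
  have a row-finite left factor, so that their entries are finite sums.
\<close>

type_synonym 'n semi_mat = "'n multi_index \<Rightarrow> 'n multi_index \<Rightarrow> real"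

definition semi_mult :: "'n::finite semi_mat \<Rightarrow> 'n semi_mat \<Rightarrow> 'n semi_mat" (infixl \<open>\<odot>\<close> 70) where
  "(A \<odot> B) \<alpha> \<beta> = (\<Sum>\<^sub>\<infinity>\<gamma>. A \<alpha> \<gamma> * B \<gamma> \<beta>)"

definition semi_one :: "'n::finite semi_mat" where
  "semi_one \<alpha> \<beta> = (if \<alpha> = \<beta> then 1 else 0)"

definition semi_transpose :: "'n::finite semi_mat \<Rightarrow> 'n semi_mat" where
  "semi_transpose A \<alpha> \<beta> = A \<beta> \<alpha>"

definition semi_apply ::
    "'n::finite semi_mat \<Rightarrow> ('n multi_index \<Rightarrow> 'a::real_normed_vector) \<Rightarrow> 'n multi_index \<Rightarrow> 'a" where
  "semi_apply A v \<alpha> = (\<Sum>\<^sub>\<infinity>\<beta>. A \<alpha> \<beta> *\<^sub>R v \<beta>)"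

definition semi_truncate :: "nat \<Rightarrow> 'n::{finite,linorder} semi_mat \<Rightarrow> real mat" where
  "semi_truncate l A =
    (let xs = concat (map mi_block_list [0..<l])
     in mat (length xs) (length xs) (\<lambda>(i, j). A (xs ! i) (xs ! j)))"

definition block_unitriangular :: "'n::finite semi_mat \<Rightarrow> bool" where
  "block_unitriangular A \<longleftrightarrow>
    (\<forall>\<alpha> \<beta>. mi_degree \<alpha> < mi_degree \<beta> \<longrightarrow> A \<alpha> \<beta> = 0) \<and>
    (\<forall>\<alpha> \<beta>. mi_degree \<alpha> = mi_degree \<beta> \<longrightarrow> A \<alpha> \<beta> = semi_one \<alpha> \<beta>)"

definition block_diagonal :: "'n::finite semi_mat \<Rightarrow> bool" where
  "block_diagonal A \<longleftrightarrow> (\<forall>\<alpha> \<beta>. mi_degree \<alpha> \<noteq> mi_degree \<beta> \<longrightarrow> A \<alpha> \<beta> = 0)"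

text \<open>The inverse in the group of block lower unitriangular semi-infinite matrices.\<close>

definition semi_inverse :: "'n::finite semi_mat \<Rightarrow> 'n semi_mat" where
  "semi_inverse A = (THE B. block_unitriangular B \<and> A \<odot> B = semi_one \<and> B \<odot> A = semi_one)"

text \<open>
  A Borel measure on \<open>\<Omega> \<subseteq> \<real>\<^sup>D\<close> lives on the Borel \<open>\<sigma>\<close>-algebra of the subspace \<open>\<Omega>\<close>, which need not
  be a Borel set itself. Its support is a closed subset of \<open>\<real>\<^sup>D\<close>.
\<close>

definition borel_measure_on :: "(real ^ 'n) set \<Rightarrow> (real ^ 'n) measure \<Rightarrow> bool" where
  "borel_measure_on \<Omega> \<mu> \<longleftrightarrow> sets \<mu> = sets (restrict_space borel \<Omega>)"

definition finite_moments :: "(real ^ 'n::finite) measure \<Rightarrow> bool" where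
  "finite_moments \<mu> \<longleftrightarrow> (\<forall>\<alpha>. integrable \<mu> (monom_eval \<alpha>))"

definition measure_support :: "(real ^ 'n::finite) measure \<Rightarrow> (real ^ 'n) set" where
  "measure_support \<mu> = {x. \<forall>U. open U \<and> x \<in> U \<longrightarrow> emeasure \<mu> (U \<inter> space \<mu>) \<noteq> 0}"

definition moment_matrix :: "(real ^ 'n::finite) measure \<Rightarrow> 'n semi_mat" where
  "moment_matrix \<mu> \<alpha> \<beta> = (\<integral>x. monom_eval \<alpha> x * monom_eval \<beta> x \<partial>\<mu>)"

definition block_cholesky :: "'n::finite semi_mat \<Rightarrow> 'n semi_mat \<Rightarrow> 'n semi_mat \<Rightarrow> bool" where
  "block_cholesky G S H \<longleftrightarrow>
    block_unitriangular S \<and> block_diagonal H \<and>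
    G = semi_inverse S \<odot> H \<odot> semi_transpose (semi_inverse S)"

definition orth_poly :: "'n::finite semi_mat \<Rightarrow> 'n multi_index \<Rightarrow> real ^ 'n \<Rightarrow> real" where
  "orth_poly S \<alpha> x = semi_apply S (\<lambda>\<beta>. monom_eval \<beta> x) \<alpha>"

definition vec_inverse :: "complex ^ 'n::finite \<Rightarrow> complex ^ 'n" where
  "vec_inverse z = (\<chi> a. inverse (z $ a))"

definition chi_star :: "complex ^ 'n::finite \<Rightarrow> 'n multi_index \<Rightarrow> complex" where
  "chi_star z \<beta> = (\<Prod>a\<in>UNIV. inverse (z $ a)) * monom_eval \<beta> (vec_inverse z)"

definition second_kind ::
    "'n::finite semi_mat \<Rightarrow> 'n semi_mat \<Rightarrow> 'n multi_index \<Rightarrow> complex ^ 'n \<Rightarrow> complex" where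
  "second_kind S H \<alpha> z = semi_apply (H \<odot> semi_transpose (semi_inverse S)) (chi_star z) \<alpha>"

text \<open>
  The domain of convergence, in \<open>\<complex>\<^sup>D\<close>, of the Laurent series \<open>\<Sum>\<beta>. c \<beta> z\<^sub>1\<^sup>-\<^sup>1\<cdots>z\<^sub>D\<^sup>-\<^sup>1 z\<^sup>-\<^sup>\<beta>\<close>. Some \<open>z $ a = 0\<close>
  has to be excluded explicitly because \<open>inverse 0 = 0\<close>.
\<close>

definition laurent_domain :: "('n::finite multi_index \<Rightarrow> real) \<Rightarrow> (complex ^ 'n) set" where
  "laurent_domain c =
    {z. (\<forall>a. z $ a \<noteq> 0) \<and>
        vec_inverse z \<in> interior {w. (\<lambda>\<beta>. norm (c \<beta> *\<^sub>R ((\<Prod>a\<in>UNIV. w $ a) * monom_eval \<beta> w)))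
                                        summable_on UNIV}}"

definition second_kind_domain ::
    "'n::finite semi_mat \<Rightarrow> 'n semi_mat \<Rightarrow> 'n multi_index \<Rightarrow> (complex ^ 'n) set" where
  "second_kind_domain S H \<alpha> = laurent_domain ((H \<odot> semi_transpose (semi_inverse S)) \<alpha>)"

definition complex_vec :: "real ^ 'n::finite \<Rightarrow> complex ^ 'n" where
  "complex_vec x = (\<chi> a. complex_of_real (x $ a))"

end

theory Submission
  imports Defs
begin

text \<open>
  From \<open>G = S\<^sup>-\<^sup>1 H S\<^sup>-\<^sup>T\<close> one gets \<open>H S\<^sup>-\<^sup>T = S G\<close>, so the coefficients of the series \<open>C\<^sub>\<alpha>\<close> are the
  moments \<open>\<integral> P\<^sub>\<alpha> y\<^sup>\<beta> \<partial>\<mu>\<close>. At an interior point of the domain of convergence the series still converges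
  absolutely after \<open>1/z\<close> is scaled by some \<open>t > 1\<close>. This bounds the growth of the moments so strongly
  that \<open>P\<^sub>\<alpha>\<close> vanishes almost everywhere outside the polydisc \<open>\<bar>y\<^sub>a\<bar> \<le> \<bar>z\<^sub>a\<bar>/t\<close>, and on this
  polydisc the geometric expansion of the Cauchy kernel converges uniformly, so that it can be
  integrated term by term against \<open>P\<^sub>\<alpha>\<close>.
\<close>

section \<open>Block lower triangular semi-infinite matrices\<close>

lemma finite_mi_degree_le: "finite {\<gamma> :: 'n::finite multi_index. mi_degree \<gamma> \<le> k}"
proof (rule finite_subset)
  show "{\<gamma> :: 'n multi_index. mi_degree \<gamma> \<le> k} \<subseteq> vec_lambda ` (UNIV \<rightarrow>\<^sub>E {..k})"
  proof
    fix \<gamma> :: "'n multi_index"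
    assume "\<gamma> \<in> {\<gamma>. mi_degree \<gamma> \<le> k}"
    moreover have "\<gamma> $ a \<le> mi_degree \<gamma>" for a
      unfolding mi_degree_def by (rule member_le_sum) auto
    ultimately have "vec_nth \<gamma> \<in> UNIV \<rightarrow>\<^sub>E {..k}"
      by (auto intro: order_trans)
    then show "\<gamma> \<in> vec_lambda ` (UNIV \<rightarrow>\<^sub>E {..k})"
      by (metis image_eqI vec_nth_inverse)
  qed
qed (intro finite_imageI finite_PiE, auto)

lemma finite_mi_degree_less: "finite {\<gamma> :: 'n::finite multi_index. mi_degree \<gamma> < k}"
  by (rule finite_subset[OF _ finite_mi_degree_le[of k]]) auto

text \<open>The shape shared by \<open>S\<close>, its inverse and \<open>H\<close>. Rows of such a
  matrix have finite support, so products with it on the left are finite sums.\<close>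

definition block_lower :: "'n::finite semi_mat \<Rightarrow> bool" where
  "block_lower A \<longleftrightarrow> (\<forall>\<alpha> \<beta>. mi_degree \<alpha> < mi_degree \<beta> \<longrightarrow> A \<alpha> \<beta> = 0)"

lemma block_lower_unitriangular: "block_unitriangular A \<Longrightarrow> block_lower A"
  by (auto simp: block_lower_def block_unitriangular_def)

lemma block_lower_diagonal: "block_diagonal A \<Longrightarrow> block_lower A"
  by (auto simp: block_lower_def block_diagonal_def)

text \<open>The bound \<open>k\<close> may exceed the degree of \<alpha>, so that the proof of
  associativity can sum all rows over one common index set.\<close>

lemma semi_apply_eq_sum:
  assumes "block_lower A" "mi_degree \<alpha> \<le> k"
  shows "semi_apply A v \<alpha> = (\<Sum>\<gamma> | mi_degree \<gamma> \<le> k. A \<alpha> \<gamma> *\<^sub>R v \<gamma>)"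
proof -
  have "semi_apply A v \<alpha> = (\<Sum>\<^sub>\<infinity>\<gamma>\<in>{\<gamma>. mi_degree \<gamma> \<le> k}. A \<alpha> \<gamma> *\<^sub>R v \<gamma>)"
    unfolding semi_apply_def
    by (rule infsum_cong_neutral) (use assms in \<open>auto simp: block_lower_def\<close>)
  then show ?thesis by (simp add: finite_mi_degree_le)
qed

lemma semi_mult_eq_sum:
  assumes "block_lower A" "mi_degree \<alpha> \<le> k"
  shows "(A \<odot> B) \<alpha> \<beta> = (\<Sum>\<gamma> | mi_degree \<gamma> \<le> k. A \<alpha> \<gamma> * B \<gamma> \<beta>)"
  using semi_apply_eq_sum[OF assms, of "\<lambda>\<gamma>. B \<gamma> \<beta>"] by (simp add: semi_apply_def semi_mult_def)

lemma block_lower_mult: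
  assumes "block_lower A" "block_lower B"
  shows "block_lower (A \<odot> B)"
  using assms(2) by (auto simp: block_lower_def semi_mult_eq_sum[OF assms(1) order_refl] intro!: sum.neutral)

text \<open>Both sides are one finite double sum in two orders. \<open>C\<close> is arbitrary
  because it must cover the upper triangular \<open>semi_transpose (semi_inverse S)\<close>.\<close>

lemma semi_mult_assoc:
  fixes A B C :: "'n::finite semi_mat"
  assumes "block_lower A" "block_lower B"
  shows "(A \<odot> B) \<odot> C = A \<odot> (B \<odot> C)"
proof (intro ext)
  fix \<alpha> \<beta> :: "'n multi_index"
  let ?I = "{\<gamma> :: 'n multi_index. mi_degree \<gamma> \<le> mi_degree \<alpha>}"
  have "((A \<odot> B) \<odot> C) \<alpha> \<beta> = (\<Sum>\<gamma>\<in>?I. (\<Sum>\<delta>\<in>?I. A \<alpha> \<delta> * B \<delta> \<gamma>) * C \<gamma> \<beta>)"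
    by (simp add: semi_mult_eq_sum[OF block_lower_mult[OF assms] order_refl]
        semi_mult_eq_sum[OF assms(1) order_refl])
  also have "\<dots> = (\<Sum>\<delta>\<in>?I. A \<alpha> \<delta> * (\<Sum>\<gamma>\<in>?I. B \<delta> \<gamma> * C \<gamma> \<beta>))"
    unfolding sum_distrib_left sum_distrib_right by (subst sum.swap) (simp add: mult.assoc)
  also have "\<dots> = (A \<odot> (B \<odot> C)) \<alpha> \<beta>"
    unfolding semi_mult_eq_sum[OF assms(1) order_refl]
    by (intro sum.cong refl arg_cong2[of _ _ _ _ times] semi_mult_eq_sum[OF assms(2), symmetric]) auto
  finally show "((A \<odot> B) \<odot> C) \<alpha> \<beta> = (A \<odot> (B \<odot> C)) \<alpha> \<beta>" .
qed

lemma block_lower_one: "block_lower semi_one"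
  by (auto simp: block_lower_def semi_one_def)

lemma semi_one_mult: "semi_one \<odot> A = A"
  by (intro ext) (simp add: semi_mult_eq_sum[OF block_lower_one order_refl] semi_one_def
      if_distrib[of "\<lambda>x. x * _"] finite_mi_degree_le cong: if_cong)

lemma semi_mult_one: "block_lower A \<Longrightarrow> A \<odot> semi_one = A"
  by (intro ext) (auto simp: semi_mult_eq_sum[OF _ order_refl] semi_one_def block_lower_def
      if_distrib[of "\<lambda>x. _ * x"] finite_mi_degree_le cong: if_cong)

section \<open>Inversion by forward substitution\<close>

text \<open>When the diagonal blocks of \<open>A\<close> are identities,
  \<open>A \<odot> B = semi_one\<close> determines each row of \<open>B\<close> from its rows of
  lower degree.\<close>

function forward_subst :: "'n::finite semi_mat \<Rightarrow> 'n semi_mat" where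
  "forward_subst A \<alpha> \<beta> =
    semi_one \<alpha> \<beta> - (\<Sum>\<gamma>\<in>{\<gamma>. mi_degree \<gamma> < mi_degree \<alpha>}. A \<alpha> \<gamma> * forward_subst A \<gamma> \<beta>)"
  by auto
termination by (relation "Wellfounded.measure (\<lambda>(A, \<alpha>, \<beta>). mi_degree \<alpha>)") auto

declare forward_subst.simps [simp del]

text \<open>The recursion sums over rows of degree below that of \<alpha>; their entries vanish by
  induction once \<beta> has at least the degree of \<alpha>, and only \<open>semi_one\<close>
  remains.\<close>

lemma block_unitriangular_forward_subst: "block_unitriangular (forward_subst A)"
proof -
  have lower: "forward_subst A \<alpha> \<beta> = 0" if "mi_degree \<alpha> < mi_degree \<beta>" for \<alpha> \<beta>
    using that
  proof (induction "mi_degree \<alpha>" arbitrary: \<alpha> rule: less_induct)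
    case less
    then show ?case
      by (subst forward_subst.simps) (auto simp: semi_one_def intro!: sum.neutral)
  qed
  have "forward_subst A \<alpha> \<beta> = semi_one \<alpha> \<beta>" if "mi_degree \<alpha> = mi_degree \<beta>" for \<alpha> \<beta>
    by (subst forward_subst.simps) (auto simp: lower that intro!: sum.neutral)
  with lower show ?thesis by (simp add: block_unitriangular_def)
qed

text \<open>The row sum is split by degree: the identity diagonal block of \<open>A\<close>
  contributes \<open>forward_subst A \<alpha> \<beta>\<close> itself, whose recursion cancels the
  part of lower degree.\<close>

lemma semi_mult_forward_subst:
  fixes A :: "'n::finite semi_mat"
  assumes "block_unitriangular A"
  shows "A \<odot> forward_subst A = semi_one"
proof (intro ext)
  fix \<alpha> \<beta> :: "'n multi_index"
  let ?L = "{\<gamma> :: 'n multi_index. mi_degree \<gamma> < mi_degree \<alpha>}"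
    and ?E = "{\<gamma> :: 'n multi_index. mi_degree \<gamma> = mi_degree \<alpha>}"
  let ?f = "\<lambda>\<gamma>. A \<alpha> \<gamma> * forward_subst A \<gamma> \<beta>"
  have finE: "finite ?E"
    by (rule finite_subset[OF _ finite_mi_degree_le[of "mi_degree \<alpha>"]]) auto
  have "(A \<odot> forward_subst A) \<alpha> \<beta> = sum ?f (?L \<union> ?E)"
    unfolding semi_mult_eq_sum[OF block_lower_unitriangular[OF assms] order_refl]
    by (rule sum.cong) auto
  also have "\<dots> = sum ?f ?L + sum ?f ?E"
    by (rule sum.union_disjoint) (auto simp: finite_mi_degree_less finE)
  also have "sum ?f ?E = (\<Sum>\<gamma>\<in>?E. if \<alpha> = \<gamma> then forward_subst A \<gamma> \<beta> else 0)"
    using assms by (intro sum.cong) (auto simp: block_unitriangular_def semi_one_def)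
  also have "\<dots> = forward_subst A \<alpha> \<beta>"
    using finE by simp
  also have "sum ?f ?L + forward_subst A \<alpha> \<beta> = semi_one \<alpha> \<beta>"
    by (subst (2) forward_subst.simps) simp
  finally show "(A \<odot> forward_subst A) \<alpha> \<beta> = semi_one \<alpha> \<beta>" .
qed

text \<open>Forward substitution yields right inverses only. But \<open>forward_subst A\<close> has
  a right inverse too, which associativity identifies with \<open>A\<close>. Uniqueness, which the
  definite description requires, also follows from associativity.\<close>

lemma block_unitriangular_inverse:
  assumes "block_unitriangular A"
  shows "block_unitriangular (semi_inverse A) \<and> A \<odot> semi_inverse A = semi_one \<and>
    semi_inverse A \<odot> A = semi_one"
  unfolding semi_inverse_def
proof (rule theI[where a = "forward_subst A"], intro conjI)
  let ?B = "forward_subst A"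
  note low = block_lower_unitriangular block_unitriangular_forward_subst assms
  show "block_unitriangular ?B" by (rule block_unitriangular_forward_subst)
  show AB: "A \<odot> ?B = semi_one" by (rule semi_mult_forward_subst[OF assms])
  have BC: "?B \<odot> forward_subst ?B = semi_one"
    by (rule semi_mult_forward_subst[OF block_unitriangular_forward_subst])
  have "A = A \<odot> (?B \<odot> forward_subst ?B)"
    by (simp add: BC semi_mult_one low)
  also have "\<dots> = forward_subst ?B"
    by (simp add: semi_mult_assoc[symmetric] low AB semi_one_mult)
  finally show "?B \<odot> A = semi_one" using BC by simp
  fix C assume C: "block_unitriangular C \<and> A \<odot> C = semi_one \<and> C \<odot> A = semi_one"
  have "C = C \<odot> (A \<odot> ?B)" using C by (simp add: AB semi_mult_one low)
  also have "\<dots> = ?B" using C by (simp add: semi_mult_assoc[symmetric] low semi_one_mult)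
  finally show "C = ?B" .
qed

text \<open>Left multiplication by \<open>S\<close> cancels the leading
  \<open>semi_inverse S\<close>. The right-hand side holds the coefficients of the second kind
  functions, the left-hand side integrals against \<mu>.\<close>

lemma block_cholesky_mult_left:
  assumes "block_cholesky G S H"
  shows "S \<odot> G = H \<odot> semi_transpose (semi_inverse S)"
proof -
  let ?R = "semi_inverse S"
  have S: "block_unitriangular S" and H: "block_diagonal H"
    and G: "G = ?R \<odot> H \<odot> semi_transpose ?R"
    using assms by (auto simp: block_cholesky_def)
  have R: "block_unitriangular ?R" "S \<odot> ?R = semi_one"
    using block_unitriangular_inverse[OF S] by auto
  note low = block_lower_unitriangular[OF S] block_lower_unitriangular[OF R(1)]
    block_lower_diagonal[OF H] block_lower_mult
  have "S \<odot> G = (S \<odot> ?R) \<odot> H \<odot> semi_transpose ?R"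
    by (simp add: G semi_mult_assoc low)
  then show ?thesis by (simp add: R semi_one_mult)
qed

section \<open>Geometric series and the Cauchy kernel\<close>

lemma monom_eval_add: "monom_eval (\<alpha> + \<beta>) x = monom_eval \<alpha> x * monom_eval \<beta> x"
  by (simp add: monom_eval_def power_add prod.distrib)

lemma monom_eval_axis: "monom_eval (axis a m) x = (x $ a) ^ m"
proof -
  have "monom_eval (axis a m) x = (\<Prod>b\<in>UNIV. if b = a then (x $ b) ^ m else 1)"
    unfolding monom_eval_def axis_def by (intro prod.cong) auto
  then show ?thesis by simp
qed

lemma norm_monom_eval:
  fixes x :: "'a::real_normed_field ^ 'n::finite"
  shows "norm (monom_eval \<beta> x) = monom_eval \<beta> (\<chi> a. norm (x $ a))"
  by (simp add: monom_eval_def prod_norm[symmetric] norm_power)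

text \<open>A multi-index is a function on the coordinates, so expanding a product of geometric
  series gives a sum over all multi-indices.\<close>

lemma infsum_monom_eval:
  fixes x :: "'a::{banach, real_normed_field} ^ 'n::finite"
  assumes "\<And>a. norm (x $ a) < 1"
  shows "(\<Sum>\<^sub>\<infinity>\<beta>. monom_eval \<beta> x) = (\<Prod>a\<in>UNIV. 1 / (1 - x $ a))"
proof -
  have bij: "bij_betw vec_nth UNIV (UNIV \<rightarrow>\<^sub>E (UNIV :: nat set) :: ('n \<Rightarrow> nat) set)"
    by (rule bij_betwI[where g = vec_lambda]) auto
  have sum1: "((\<lambda>n. (x $ a) ^ n) has_sum (1 / (1 - x $ a))) UNIV" for a
    using assms[of a] by (intro norm_summable_imp_has_sum geometric_sums)
      (auto simp: norm_power intro: summable_geometric)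
  have abs1: "(\<lambda>n. norm ((x $ a) ^ n)) summable_on UNIV" for a
    using assms[of a] by (intro norm_summable_imp_summable_on)
      (auto simp: norm_power intro: summable_geometric)
  have "(\<Sum>\<^sub>\<infinity>\<beta>. monom_eval \<beta> x) = (\<Sum>\<^sub>\<infinity>g\<in>UNIV \<rightarrow>\<^sub>E UNIV. \<Prod>a\<in>UNIV. (x $ a) ^ g a)"
    unfolding monom_eval_def by (rule infsum_reindex_bij_betw[OF bij])
  also have "\<dots> = (\<Prod>a\<in>UNIV. \<Sum>\<^sub>\<infinity>n. (x $ a) ^ n)"
    by (rule infsum_prod_PiE_abs) (use abs1 in auto)
  also have "\<dots> = (\<Prod>a\<in>UNIV. 1 / (1 - x $ a))"
    by (intro prod.cong refl infsumI sum1)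
  finally show ?thesis .
qed

text \<open>Summability is read off from the value: \<open>infsum\<close> defaults to 0 on families
  that are not summable, while the product formula gives 0 only if some \<open>x $ a\<close> equals
  1, where division by zero yields 0.\<close>

lemma summable_monom_eval_real:
  fixes x :: "real ^ 'n::finite"
  assumes "\<And>a. \<bar>x $ a\<bar> < 1"
  shows "(\<lambda>\<beta>. monom_eval \<beta> x) summable_on UNIV"
proof (rule ccontr)
  assume "\<not> ?thesis"
  then have "(\<Prod>a\<in>UNIV. 1 / (1 - x $ a)) = 0"
    using infsum_monom_eval[of x] assms by (simp add: infsum_not_exists)
  then obtain a where "x $ a = 1" by auto
  with assms[of a] show False by simp
qed

lemma monom_eval_complex_of_real:
  "monom_eval \<beta> (\<chi> a. x $ a * complex_of_real (y $ a)) = monom_eval \<beta> x * complex_of_real (monom_eval \<beta> y)"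
  by (simp add: monom_eval_def power_mult_distrib prod.distrib)

text \<open>Weierstrass test: on the polydisc all ratios of \<open>y $ a\<close> to
  \<open>z $ a\<close> have modulus at most \<open>1 / t < 1\<close>, so a convergent geometric
  series in \<open>?q\<close> dominates.\<close>

lemma uniform_limit_cauchy_kernel:
  fixes z :: "complex ^ 'n::finite"
  assumes z: "\<And>a. z $ a \<noteq> 0" and t: "t > 1"
  shows "uniform_limit {y. \<forall>a. \<bar>y $ a\<bar> \<le> norm (z $ a) / t}
    (\<lambda>F y. \<Sum>\<beta>\<in>F. chi_star z \<beta> * complex_of_real (monom_eval \<beta> y))
    (\<lambda>y. 1 / (\<Prod>a\<in>UNIV. z $ a - complex_of_real (y $ a))) (finite_subsets_at_top UNIV)"
    (is "uniform_limit ?Y ?s ?K _")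
proof -
  let ?c = "\<Prod>a\<in>UNIV. inverse (z $ a)"
  let ?q = "(\<chi> a. 1 / t) :: real ^ 'n"
  \<comment> \<open>Pulling out each factor \<open>inverse (z $ a)\<close> leaves
    \<open>1 / (1 - u y $ a)\<close>.\<close>
  define u where "u y = (\<chi> a. inverse (z $ a) * complex_of_real (y $ a))" for y
  have term_eq: "chi_star z \<beta> * complex_of_real (monom_eval \<beta> y) = ?c * monom_eval \<beta> (u y)" for \<beta> y
    using monom_eval_complex_of_real[of \<beta> "vec_inverse z" y]
    by (simp add: chi_star_def u_def vec_inverse_def)
  have u_le: "norm (u y $ a) \<le> 1 / t" if "y \<in> ?Y" for y a
    using that z[of a] t by (auto simp: u_def norm_mult norm_inverse divide_simps mult.commute norm_divide)
  have u_less: "norm (u y $ a) < 1" if "y \<in> ?Y" for y a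
    using le_less_trans[OF u_le[OF that, of a], of 1] t by simp
  have le: "norm (chi_star z \<beta> * complex_of_real (monom_eval \<beta> y)) \<le> norm ?c * monom_eval \<beta> ?q"
    if "y \<in> ?Y" for \<beta> y
    unfolding term_eq norm_mult norm_monom_eval
    unfolding monom_eval_def
    by (intro mult_left_mono prod_mono conjI power_mono) (use u_le[OF that] in \<open>auto intro!: prod_nonneg\<close>)
  have "(\<lambda>\<beta>. norm ?c * monom_eval \<beta> ?q) summable_on UNIV"
    by (intro summable_on_cmult_right summable_monom_eval_real) (use t in auto)
  with le have "uniform_limit ?Y ?s (\<lambda>y. \<Sum>\<^sub>\<infinity>\<beta>. chi_star z \<beta> * complex_of_real (monom_eval \<beta> y))
      (finite_subsets_at_top UNIV)"
    by (intro Weierstrass_m_test_general) auto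
  moreover have "(\<Sum>\<^sub>\<infinity>\<beta>. chi_star z \<beta> * complex_of_real (monom_eval \<beta> y)) = ?K y" if "y \<in> ?Y" for y
  proof -
    have "(\<Sum>\<^sub>\<infinity>\<beta>. chi_star z \<beta> * complex_of_real (monom_eval \<beta> y)) =
        ?c * (\<Prod>a\<in>UNIV. 1 / (1 - u y $ a))"
      unfolding term_eq using u_less[OF that] by (simp add: infsum_cmult_right' infsum_monom_eval)
    also have "\<dots> = (\<Prod>a\<in>UNIV. 1 / (z $ a - complex_of_real (y $ a)))"
      unfolding prod.distrib[symmetric]
      by (intro prod.cong refl) (use z in \<open>auto simp: u_def field_simps\<close>)
    finally show ?thesis by (simp add: prod_dividef)
  qed
  ultimately show ?thesis
    by (subst uniform_limit_cong'[where g = ?s]) auto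
qed

section \<open>Moments of the orthogonal polynomials\<close>

lemma orth_poly_eq_sum:
  assumes "block_unitriangular S"
  shows "orth_poly S \<alpha> y = (\<Sum>\<gamma> | mi_degree \<gamma> \<le> mi_degree \<alpha>. S \<alpha> \<gamma> * monom_eval \<gamma> y)"
  using semi_apply_eq_sum[OF block_lower_unitriangular[OF assms] order_refl, where v = "\<lambda>\<gamma>. monom_eval \<gamma> y"]
  by (simp add: orth_poly_def)

lemma integrable_orth_poly_monom:
  assumes "finite_moments \<mu>" "block_unitriangular S"
  shows "integrable \<mu> (\<lambda>y. orth_poly S \<alpha> y * monom_eval \<beta> y)"
  unfolding orth_poly_eq_sum[OF assms(2)] sum_distrib_right mult.assoc monom_eval_add[symmetric]
  using assms(1) by (intro Bochner_Integration.integrable_sum integrable_mult_right)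
    (simp add: finite_moments_def)

text \<open>The finite sum over row \<alpha> of \<open>S\<close> moves under the integral. With
  \<open>block_cholesky_mult_left\<close> this makes the series coefficients moments of the
  polynomial.\<close>

lemma semi_mult_moment_matrix:
  assumes "finite_moments \<mu>" "block_unitriangular S"
  shows "(S \<odot> moment_matrix \<mu>) \<alpha> \<beta> = (\<integral>y. orth_poly S \<alpha> y * monom_eval \<beta> y \<partial>\<mu>)"
proof -
  have int: "integrable \<mu> (\<lambda>y. monom_eval \<gamma> y * monom_eval \<beta> y)" for \<gamma>
    using assms(1) by (simp add: finite_moments_def monom_eval_add[symmetric])
  show ?thesis
    unfolding orth_poly_eq_sum[OF assms(2)] sum_distrib_right mult.assoc moment_matrix_def
      semi_mult_eq_sum[OF block_lower_unitriangular[OF assms(2)] order_refl]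
    by (subst Bochner_Integration.integral_sum) (auto intro: int)
qed

lemma integrable_orth_poly:
  assumes "finite_moments \<mu>" "block_unitriangular S"
  shows "integrable \<mu> (orth_poly S \<alpha>)"
  using integrable_orth_poly_monom[OF assms, of \<alpha> 0] by (simp add: monom_eval_def)

text \<open>A coordinate is itself a monomial, so \<open>finite_moments\<close> supplies its
  measurability.\<close>

lemma borel_measurable_component:
  fixes \<mu> :: "(real ^ 'n::finite) measure"
  assumes "finite_moments \<mu>"
  shows "(\<lambda>y. y $ a) \<in> borel_measurable \<mu>"
proof -
  have "monom_eval (axis a 1) = (\<lambda>y :: real ^ 'n. y $ a)"
    by (rule ext) (simp add: monom_eval_axis)
  then show ?thesis
    using assms by (metis borel_measurable_integrable finite_moments_def)
qed

section \<open>Vanishing of the polynomial outside a polydisc\<close>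

text \<open>
  Squaring \<open>P\<close> makes the measure \<open>P\<^sup>2 \<mu>\<close> positive, so that the decay of its scaled moments
  \<open>\<integral> P\<^sup>2 (q y\<^sub>a)\<^sup>2\<^sup>n \<partial>\<mu>\<close>, which are finite combinations of the coefficients of the series,
  forces \<open>P = 0\<close> almost everywhere on \<open>q \<bar>y\<^sub>a\<bar> > 1\<close>.
\<close>

lemma AE_orth_poly_zero_outside:
  fixes \<mu> :: "(real ^ 'n::finite) measure" and w :: "complex ^ 'n"
  assumes fm: "finite_moments \<mu>" and S: "block_unitriangular S"
    and w: "\<And>b. w $ b \<noteq> 0"
    and summable: "(\<lambda>\<beta>. norm ((\<integral>y. orth_poly S \<alpha> y * monom_eval \<beta> y \<partial>\<mu>) *\<^sub>R
      ((\<Prod>b\<in>UNIV. w $ b) * monom_eval \<beta> w))) summable_on UNIV"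
  shows "AE y in \<mu>. orth_poly S \<alpha> y = 0 \<or> norm (w $ a) * \<bar>y $ a\<bar> \<le> 1"
proof -
  let ?P = "orth_poly S \<alpha>"
  let ?I = "{\<gamma> :: 'n multi_index. mi_degree \<gamma> \<le> mi_degree \<alpha>}"
  define q where "q = norm (w $ a)"
  define c where "c \<beta> = (\<integral>y. ?P y * monom_eval \<beta> y \<partial>\<mu>)" for \<beta>
  define J where "J n y = (?P y)\<^sup>2 * (q * \<bar>y $ a\<bar>) ^ (2 * n)" for n y
  \<comment> \<open>Only one of the two factors \<open>?P y\<close> is expanded, so that every term
    is a moment of the form \<open>c\<close>.\<close>
  have J_eq: "J n y = (\<Sum>\<gamma>\<in>?I. S \<alpha> \<gamma> * q ^ (2 * n) * (?P y * monom_eval (\<gamma> + axis a (2 * n)) y))" for n y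
  proof -
    have "J n y = ?P y * (?P y * (q * (y $ a)) ^ (2 * n))"
      by (simp add: J_def power2_eq_square power_mult_distrib power_even_abs)
    also have "\<dots> = (\<Sum>\<gamma>\<in>?I. S \<alpha> \<gamma> * monom_eval \<gamma> y) * (?P y * (q * (y $ a)) ^ (2 * n))"
      by (subst orth_poly_eq_sum[OF S]) (rule refl)
    also have "\<dots> = (\<Sum>\<gamma>\<in>?I. S \<alpha> \<gamma> * q ^ (2 * n) * (?P y * monom_eval (\<gamma> + axis a (2 * n)) y))"
      unfolding sum_distrib_right monom_eval_add monom_eval_axis
      by (intro sum.cong refl) (simp add: power_mult_distrib)
    finally show ?thesis .
  qed
  note int = integrable_orth_poly_monom[OF fm S]
  have J_int: "integrable \<mu> (J n)" for n
    unfolding J_eq by (intro Bochner_Integration.integrable_sum integrable_mult_right int)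
  have J_integral: "integral\<^sup>L \<mu> (J n) = (\<Sum>\<gamma>\<in>?I. S \<alpha> \<gamma> * (q ^ (2 * n) * c (\<gamma> + axis a (2 * n))))" for n
    unfolding J_eq c_def
    by (subst Bochner_Integration.integral_sum) (auto intro!: integrable_mult_right int simp: mult.assoc)
  \<comment> \<open>Up to the positive factor \<open>?K\<close>, these are in modulus the terms of
    the summable family along an injective sequence of indices.\<close>
  have "(\<lambda>n. q ^ (2 * n) * c (\<gamma> + axis a (2 * n))) \<longlonglongrightarrow> 0" for \<gamma>
  proof -
    let ?K = "norm ((\<Prod>b\<in>UNIV. w $ b) * monom_eval \<gamma> w)"
    let ?f = "\<lambda>\<beta>. norm (c \<beta> *\<^sub>R ((\<Prod>b\<in>UNIV. w $ b) * monom_eval \<beta> w))"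
    let ?h = "\<lambda>n. \<gamma> + axis a (2 * n)"
    have K: "?K > 0" using w by (simp add: monom_eval_def)
    have inj: "inj ?h"
      by (rule injI) (auto simp: axis_eq_axis)
    have "?f summable_on range ?h"
      by (rule summable_on_subset_banach[of _ UNIV]) (use summable in \<open>auto simp: c_def\<close>)
    then have "(?f \<circ> ?h) summable_on UNIV"
      using summable_on_reindex[OF inj] by blast
    then have "(?f \<circ> ?h) \<longlonglongrightarrow> 0"
      by (intro summable_LIMSEQ_zero summable_on_imp_summable)
    moreover have "(?f \<circ> ?h) n = \<bar>q ^ (2 * n) * c (?h n)\<bar> * ?K" for n
      by (simp add: monom_eval_add monom_eval_axis norm_mult norm_power q_def abs_mult)
    ultimately have "(\<lambda>n. \<bar>q ^ (2 * n) * c (?h n)\<bar> * ?K) \<longlonglongrightarrow> 0"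
      by (simp add: comp_def fun_eq_iff)
    then have "(\<lambda>n. \<bar>q ^ (2 * n) * c (?h n)\<bar> * ?K / ?K) \<longlonglongrightarrow> 0 / ?K"
      using K by (intro tendsto_divide tendsto_const) auto
    then show ?thesis using K by (simp add: tendsto_rabs_zero_iff)
  qed
  then have "(\<lambda>n. integral\<^sup>L \<mu> (J n)) \<longlonglongrightarrow> (\<Sum>\<gamma>\<in>?I. S \<alpha> \<gamma> * 0)"
    unfolding J_integral by (intro tendsto_sum tendsto_mult tendsto_const)
  then have J_lim: "(\<lambda>n. integral\<^sup>L \<mu> (J n)) \<longlonglongrightarrow> 0" by simp
  \<comment> \<open>On this region the powers in \<open>J n\<close> are at least 1, so
    \<open>T\<close> lies below every \<open>J n\<close> at once.\<close>
  define T where "T y = (?P y)\<^sup>2 * indicator {x. 1 < q * \<bar>x $ a\<bar>} y" for y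
  have T_le: "T y \<le> J n y" for n y
  proof (cases "1 < q * \<bar>y $ a\<bar>")
    case True
    then have "1 \<le> (q * \<bar>y $ a\<bar>) ^ (2 * n)" by (intro one_le_power) simp
    from mult_left_mono[OF this, of "(?P y)\<^sup>2"] True show ?thesis by (simp add: T_def J_def)
  qed (simp add: T_def J_def)
  have T_nonneg: "0 \<le> T y" for y by (simp add: T_def indicator_def)
  have [measurable]: "(\<lambda>y. y $ b) \<in> borel_measurable \<mu>" "?P \<in> borel_measurable \<mu>" for b
    using borel_measurable_component[OF fm] integrable_orth_poly[OF fm S] by auto
  have T_alt: "T = (\<lambda>y. if 1 < q * \<bar>y $ a\<bar> then (?P y)\<^sup>2 else 0)"
    by (auto simp: T_def)
  have T_int: "integrable \<mu> T"
  proof (rule Bochner_Integration.integrable_bound[OF J_int[of 0]])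
    show "T \<in> borel_measurable \<mu>" unfolding T_alt by measurable
    show "AE y in \<mu>. norm (T y) \<le> norm (J 0 y)"
      using T_le[of _ 0] T_nonneg by (intro AE_I2) (metis abs_of_nonneg order_trans real_norm_def)
  qed
  have "integral\<^sup>L \<mu> T \<le> integral\<^sup>L \<mu> (J n)" for n
    by (intro integral_mono T_int J_int T_le)
  with J_lim have "integral\<^sup>L \<mu> T \<le> 0"
    by (intro LIMSEQ_le_const) auto
  moreover have "0 \<le> integral\<^sup>L \<mu> T"
    by (simp add: T_nonneg)
  ultimately have "AE y in \<mu>. T y = 0"
    using integral_nonneg_eq_0_iff_AE[OF T_int] T_nonneg by auto
  then show ?thesis
    by (rule AE_mp) (auto simp: T_alt q_def split: if_splits intro!: AE_I2)
qed

section \<open>Interior points and the Cauchy transform\<close>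

text \<open>A ball around \<open>vec_inverse z\<close> contains a slightly larger multiple of it;
  the factor \<open>t\<close> is the margin that keeps the geometric series uniform.\<close>

lemma laurent_domainE:
  assumes "z \<in> laurent_domain c"
  obtains t where "t > 1" "\<And>a. z $ a \<noteq> 0"
    "(\<lambda>\<beta>. norm (c \<beta> *\<^sub>R ((\<Prod>a\<in>UNIV. (t *\<^sub>R vec_inverse z) $ a) *
        monom_eval \<beta> (t *\<^sub>R vec_inverse z)))) summable_on UNIV"
proof -
  let ?w = "vec_inverse z"
  let ?A = "{w. (\<lambda>\<beta>. norm (c \<beta> *\<^sub>R ((\<Prod>a\<in>UNIV. w $ a) * monom_eval \<beta> w))) summable_on UNIV}"
  have z: "\<And>a. z $ a \<noteq> 0" and "?w \<in> interior ?A"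
    using assms by (auto simp: laurent_domain_def)
  then obtain e where e: "e > 0" "ball ?w e \<subseteq> ?A"
    by (auto simp: mem_interior)
  \<comment> \<open>The radial shift has length \<open>d * norm ?w\<close>, strictly below
    \<open>e\<close> thanks to the added 1.\<close>
  define d where "d = e / (norm ?w + 1)"
  have d: "d > 0" using e by (simp add: d_def add_nonneg_pos)
  have "dist ?w ((1 + d) *\<^sub>R ?w) = d * norm ?w"
    using d by (simp add: dist_norm scaleR_add_left)
  also have "\<dots> < d * (norm ?w + 1)" using d by simp
  also have "\<dots> = e" unfolding d_def by (simp add: add_nonneg_eq_0_iff)
  finally have "(1 + d) *\<^sub>R ?w \<in> ?A" using e by auto
  then show ?thesis using d z by (intro that[of "1 + d"]) auto
qed

theorem proposition2p5p1:
  fixes \<Omega> :: "(real ^ 'n::{finite,linorder}) set"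
    and \<mu> :: "(real ^ 'n::{finite,linorder}) measure"
    and S H :: "'n::{finite,linorder} semi_mat"
    and k :: nat
    and \<alpha> :: "'n::{finite,linorder} multi_index"
    and z :: "complex ^ 'n::{finite,linorder}"
  assumes "borel_measure_on \<Omega> \<mu>"
    and "finite_moments \<mu>"
    and "\<And>l. Determinant.det (semi_truncate l (moment_matrix \<mu>)) \<noteq> 0"
    and "block_cholesky (moment_matrix \<mu>) S H"
    and "\<alpha> \<in> mi_block k"
    and "z \<in> second_kind_domain S H \<alpha> - complex_vec ` measure_support \<mu>"
  shows "integrable \<mu> (\<lambda>y. complex_of_real (orth_poly S \<alpha> y) /
                             (\<Prod>a\<in>UNIV. z $ a - complex_of_real (y $ a))) \<and>
         second_kind S H \<alpha> z =
           (\<integral>y. complex_of_real (orth_poly S \<alpha> y) /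
                  (\<Prod>a\<in>UNIV. z $ a - complex_of_real (y $ a)) \<partial>\<mu>)"
proof -
  let ?P = "orth_poly S \<alpha>"
  let ?K = "\<lambda>y. 1 / (\<Prod>a\<in>UNIV. z $ a - complex_of_real (y $ a))"
  define c where "c \<beta> = (\<integral>y. ?P y * monom_eval \<beta> y \<partial>\<mu>)" for \<beta>
  note fm = assms(2)
  have S: "block_unitriangular S" using assms(4) by (simp add: block_cholesky_def)
  have c: "(H \<odot> semi_transpose (semi_inverse S)) \<alpha> = c"
    unfolding block_cholesky_mult_left[OF assms(4), symmetric] c_def
    by (rule ext) (rule semi_mult_moment_matrix[OF fm S])
  obtain t where t: "t > 1" and z: "\<And>a. z $ a \<noteq> 0" and
    summable: "(\<lambda>\<beta>. norm (c \<beta> *\<^sub>R ((\<Prod>a\<in>UNIV. (t *\<^sub>R vec_inverse z) $ a) *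
        monom_eval \<beta> (t *\<^sub>R vec_inverse z)))) summable_on UNIV"
    using assms(6) unfolding second_kind_domain_def c by (auto elim: laurent_domainE)
  \<comment> \<open>The bounds obtained below for the point \<open>t *\<^sub>R vec_inverse z\<close>
    cut out exactly the polydisc on which the kernel expansion is uniform.\<close>
  define Y where "Y = {y. \<forall>a. \<bar>y $ a\<bar> \<le> norm (z $ a) / t}"
  have "AE y in \<mu>. ?P y = 0 \<or> norm ((t *\<^sub>R vec_inverse z) $ a) * \<bar>y $ a\<bar> \<le> 1" for a
    by (rule AE_orth_poly_zero_outside[OF fm S _ summable[unfolded c_def]])
      (use t z in \<open>auto simp: vec_inverse_def\<close>)
  then have "AE y in \<mu>. \<forall>a. ?P y = 0 \<or> norm ((t *\<^sub>R vec_inverse z) $ a) * \<bar>y $ a\<bar> \<le> 1"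
    unfolding AE_all_countable by blast
  then have AE_Y: "AE y in \<mu>. ?P y = 0 \<or> y \<in> Y"
  proof (rule AE_mp, intro AE_I2 impI)
    fix y assume *: "\<forall>a. ?P y = 0 \<or> norm ((t *\<^sub>R vec_inverse z) $ a) * \<bar>y $ a\<bar> \<le> 1"
    have "norm ((t *\<^sub>R vec_inverse z) $ a) * \<bar>y $ a\<bar> = \<bar>y $ a\<bar> * t / norm (z $ a)" for a
      using t by (simp add: vec_inverse_def norm_inverse norm_divide field_simps)
    with * have "?P y = 0 \<or> (\<forall>a. \<bar>y $ a\<bar> * t / norm (z $ a) \<le> 1)" by simp
    then show "?P y = 0 \<or> y \<in> Y"
      using t z by (auto simp: Y_def pos_le_divide_eq pos_divide_le_eq)
  qed
  define s where "s F y = (\<Sum>\<beta>\<in>F. chi_star z \<beta> * complex_of_real (monom_eval \<beta> y))" for F y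
  have unif: "uniform_limit Y s ?K (finite_subsets_at_top UNIV)"
    unfolding Y_def s_def by (rule uniform_limit_cauchy_kernel[OF z t])
  let ?f = "\<lambda>y. complex_of_real (?P y) * ?K y"
  let ?g = "\<lambda>F y. complex_of_real (?P y) * s F y"
  have [measurable]: "(\<lambda>y. y $ a) \<in> borel_measurable \<mu>" "?P \<in> borel_measurable \<mu>" for a
    using borel_measurable_component[OF fm] integrable_orth_poly[OF fm S] by auto
  have g_eq: "?g F = (\<lambda>y. \<Sum>\<beta>\<in>F. chi_star z \<beta> * complex_of_real (?P y * monom_eval \<beta> y))" for F
    by (simp add: s_def sum_distrib_left mult_ac)
  have g_term: "integrable \<mu> (\<lambda>y. chi_star z \<beta> * complex_of_real (?P y * monom_eval \<beta> y))" for \<beta>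
    by (intro integrable_mult_right integrable_of_real integrable_orth_poly_monom[OF fm S])
  have g_int: "integrable \<mu> (?g F)" for F
    unfolding g_eq by (intro Bochner_Integration.integrable_sum g_term)
  have g_integral: "integral\<^sup>L \<mu> (?g F) = (\<Sum>\<beta>\<in>F. c \<beta> *\<^sub>R chi_star z \<beta>)" for F
    unfolding g_eq
    by (subst Bochner_Integration.integral_sum[OF g_term])
      (simp add: c_def scaleR_conv_of_real mult.commute del: of_real_mult)
  \<comment> \<open>Almost everywhere outside \<open>Y\<close> both functions vanish together with
    \<open>?P y\<close>, whatever the kernel does there; on \<open>Y\<close> the uniform bound is
    multiplied by \<open>\<bar>?P y\<bar>\<close>.\<close>
  have close: "AE y in \<mu>. norm (?g F y - ?f y) \<le> \<epsilon> * \<bar>?P y\<bar>"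
    if "\<forall>y\<in>Y. dist (s F y) (?K y) < \<epsilon>" for F \<epsilon>
    using AE_Y
  proof (rule AE_mp, intro AE_I2 impI)
    fix y assume "?P y = 0 \<or> y \<in> Y"
    then show "norm (?g F y - ?f y) \<le> \<epsilon> * \<bar>?P y\<bar>"
    proof
      assume "y \<in> Y"
      then have "norm (s F y - ?K y) \<le> \<epsilon>" using that by (auto simp: dist_norm intro: less_imp_le)
      then have "\<bar>?P y\<bar> * norm (s F y - ?K y) \<le> \<bar>?P y\<bar> * \<epsilon>" by (rule mult_left_mono) simp
      then show ?thesis
        unfolding right_diff_distrib[symmetric] norm_mult norm_of_real by (simp only: mult.commute)
    qed simp
  qed
  have absP: "integrable \<mu> (\<lambda>y. \<epsilon> * \<bar>?P y\<bar>)" for \<epsilon>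
    by (intro integrable_mult_right integrable_abs integrable_orth_poly[OF fm S])
  have meas: "?f \<in> borel_measurable \<mu>" by measurable
  have diff_int: "integrable \<mu> (\<lambda>y. ?g F y - ?f y)" if "\<forall>y\<in>Y. dist (s F y) (?K y) < \<epsilon>" for F \<epsilon>
  proof (rule Bochner_Integration.integrable_bound[OF absP[of \<epsilon>]])
    show "(\<lambda>y. ?g F y - ?f y) \<in> borel_measurable \<mu>"
      by (intro borel_measurable_diff meas borel_measurable_integrable[OF g_int])
    show "AE y in \<mu>. norm (?g F y - ?f y) \<le> norm (\<epsilon> * \<bar>?P y\<bar>)"
      using close[OF that] by (rule AE_mp) (auto intro!: AE_I2)
  qed
  have ev: "\<forall>\<^sub>F F in finite_subsets_at_top UNIV. \<forall>y\<in>Y. dist (s F y) (?K y) < \<epsilon>" if "\<epsilon> > 0" for \<epsilon>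
    using uniform_limitD[OF unif that] .
  \<comment> \<open>A single partial sum within distance 1 suffices: \<open>?f\<close> is then an
    integrable function minus an integrable error.\<close>
  obtain F0 where "\<forall>y\<in>Y. dist (s F0 y) (?K y) < 1"
    using eventually_happens'[OF finite_subsets_at_top_neq_bot ev[of 1]] by auto
  from Bochner_Integration.integrable_diff[OF g_int[of F0] diff_int[OF this]]
  have f_int: "integrable \<mu> ?f" by simp
  \<comment> \<open>Convergence along finite sets of multi-indices is the one that
    \<open>infsum\<close> in \<open>semi_apply\<close> refers to.\<close>
  have "((\<lambda>\<beta>. c \<beta> *\<^sub>R chi_star z \<beta>) has_sum integral\<^sup>L \<mu> ?f) UNIV"
    unfolding has_sum_def
  proof (rule tendstoI)
    fix e :: real assume e: "e > 0"
    let ?N = "\<integral>y. \<bar>?P y\<bar> \<partial>\<mu>"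
    have N: "?N + 1 > 0" by (intro add_nonneg_pos) simp_all
    \<comment> \<open>The added 1 covers the case \<open>?N = 0\<close> and makes the final estimate
      strict.\<close>
    define \<epsilon> where "\<epsilon> = e / (?N + 1)"
    have \<epsilon>: "\<epsilon> > 0" unfolding \<epsilon>_def by (rule divide_pos_pos[OF e N])
    show "\<forall>\<^sub>F F in finite_subsets_at_top UNIV.
        dist (\<Sum>\<beta>\<in>F. c \<beta> *\<^sub>R chi_star z \<beta>) (integral\<^sup>L \<mu> ?f) < e"
      using ev[OF \<epsilon>]
    proof eventually_elim
      case (elim F)
      have "dist (\<Sum>\<beta>\<in>F. c \<beta> *\<^sub>R chi_star z \<beta>) (integral\<^sup>L \<mu> ?f) = norm (\<integral>y. ?g F y - ?f y \<partial>\<mu>)"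
        unfolding dist_norm g_integral[symmetric] by (subst Bochner_Integration.integral_diff[OF g_int f_int]) (rule refl)
      also have "\<dots> \<le> (\<integral>y. norm (?g F y - ?f y) \<partial>\<mu>)"
        by (rule integral_norm_bound)
      also have "\<dots> \<le> (\<integral>y. \<epsilon> * \<bar>?P y\<bar> \<partial>\<mu>)"
        by (intro integral_mono_AE integrable_norm diff_int[OF elim] absP close[OF elim])
      also have "\<dots> = \<epsilon> * ?N" by simp
      also have "\<dots> < \<epsilon> * (?N + 1)" using \<epsilon> by simp
      also have "\<dots> = e" unfolding \<epsilon>_def using less_imp_neq[OF N] by simp
      finally show ?case .
    qed
  qed
  then have "second_kind S H \<alpha> z = integral\<^sup>L \<mu> ?f"
    unfolding second_kind_def semi_apply_def c by (rule infsumI)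
  with f_int show ?thesis by simp
qed

end
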